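(* Let $G$ be a complex unit hypergraph on $n$ vertices, let $r\in\{1,\dots,n-1\}$, and let $\hat G$ be obtained from $G$ by weak-deleting $r$ vertices. Let $M$ be any one of the operators $A$, $K$, or $L$ (for $L$, assume every vertex of $G$ has positive degree). Then $$\lambda_k(M(G))\le\lambda_k(M(\hat G))\le\lambda_{k+r}(M(G))\qquad\text{for all }k\in\{1,\dots,n-r\}.$$
   Context: Let $\mathbb T=\{z\in\mathbb C:|z|=1\}$. A complex unit hypergraph $G=(V,E,\mathcal I,\omega)$ consists of a finite vertex set $V=\{v_1,\dots,v_n\}$, a finite edge set $E$, an incidence set $\mathcal I\subseteq V\times E$ (write $v\in e$ if $(v,e)\in\mathcal I$), and a function $\omega:V\times E\to\mathbb T\cup\{0\}$ with $\omega(v,e)\neq0$ iff $v\in e$. Distinct vertices $v_i,v_j$ are adjacent if some edge contains both; for such an edge $e$ set $\varphi_e(v_i,v_j)=-\omega(v_i,e)\,\omega(v_j,e)^{-1}$. The degree of a vertex is the number of edges containing it; $D=\mathrm{diag}(\deg v_1,\dots,\deg v_n)$. The adjacency matrix $A=(a_{ij})$ has $a_{ij}=\sum_{e\ni v_i,v_j}\varphi_e(v_i,v_j)$ (sum over edges containing both) for $i\neq j$ adjacent, and $a_{ij}=0$ otherwise; it is Hermitian. The Kirchhoff Laplacian is $K=D-A$ (Hermitian) and the normalized Laplacian is $L=\mathrm{Id}-D^{-1}A$, which is similar to the Hermitian matrix $\mathrm{Id}-D^{-1/2}AD^{-1/2}$ and so has real eigenvalues. For a matrix $M$ with real eigenvalues,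 $\lambda_1(M)\le\dots\le\lambda_N(M)$ denote its eigenvalues in nondecreasing order with multiplicity. The weak vertex deletion of $v$ from $G$ is the complex unit hypergraph $G\setminus v$ with vertex set $V\setminus\{v\}$, the same edges (each edge $e$ replaced by $e\setminus\{v\}$), incidences $\mathcal I\cap((V\setminus\{v\})\times E)$, and $\omega$ restricted accordingly; weak-deleting $r$ vertices means performing this for $r$ distinct vertices. *)

theory Defs
  imports
    "HOL-Analysis.Analysis"
    "HOL-Library.FuncSet"
    "Jordan_Normal_Form.Char_Poly"
begin

text \<open>Edges are abstract labels: which vertices an edge contains is recorded only by the
  incidence set, so parallel edges and edges without vertices are possible.\<close>

record ('v, 'e) hypergraph =
  verts :: "'v set"
  edges :: "'e set"
  incid :: "('v \<times> 'e) set"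
  weight :: "'v \<times> 'e \<Rightarrow> complex"

definition complex_unit_hypergraph :: "('v, 'e) hypergraph \<Rightarrow> bool" where
  "complex_unit_hypergraph G \<longleftrightarrow>
     finite (verts G) \<and> finite (edges G) \<and> incid G \<subseteq> verts G \<times> edges G \<and>
     weight G \<in> verts G \<times> edges G \<rightarrow> sphere 0 1 \<union> {0} \<and>
     (\<forall>v\<in>verts G. \<forall>e\<in>edges G. weight G (v, e) \<noteq> 0 \<longleftrightarrow> (v, e) \<in> incid G)"

definition common_edges :: "('v, 'e) hypergraph \<Rightarrow> 'v \<Rightarrow> 'v \<Rightarrow> 'e set" where
  "common_edges G u v = {e \<in> edges G. (u, e) \<in> incid G \<and> (v, e) \<in> incid G}"

definition adjacent :: "('v, 'e) hypergraph \<Rightarrow> 'v \<Rightarrow> 'v \<Rightarrow> bool" where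
  "adjacent G u v \<longleftrightarrow> u \<noteq> v \<and> common_edges G u v \<noteq> {}"

definition vertex_degree :: "('v, 'e) hypergraph \<Rightarrow> 'v \<Rightarrow> nat" where
  "vertex_degree G v = card {e \<in> edges G. (v, e) \<in> incid G}"

definition edge_gain :: "('v, 'e) hypergraph \<Rightarrow> 'e \<Rightarrow> 'v \<Rightarrow> 'v \<Rightarrow> complex" where
  "edge_gain G e u v = - weight G (u, e) * inverse (weight G (v, e))"

definition adjacency_entry :: "('v, 'e) hypergraph \<Rightarrow> 'v \<Rightarrow> 'v \<Rightarrow> complex" where
  "adjacency_entry G u v =
     (if adjacent G u v then \<Sum>e\<in>common_edges G u v. edge_gain G e u v else 0)"

text \<open>The list \<open>vs\<close> is the enumeration \<open>v\<^sub>1, \<dots>, v\<^sub>n\<close> of the vertex set which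
  labels rows and columns; it is meant to satisfy the predicate \<open>enumerates vs (verts G)\<close>.\<close>

definition enumerates :: "'a list \<Rightarrow> 'a set \<Rightarrow> bool" where
  "enumerates vs V \<longleftrightarrow> distinct vs \<and> set vs = V"

definition adjacency_matrix :: "('v, 'e) hypergraph \<Rightarrow> 'v list \<Rightarrow> complex mat" where
  "adjacency_matrix G vs =
     mat (length vs) (length vs) (\<lambda>(i, j). adjacency_entry G (vs ! i) (vs ! j))"

definition degree_matrix :: "('v, 'e) hypergraph \<Rightarrow> 'v list \<Rightarrow> complex mat" where
  "degree_matrix G vs = mat_diag (length vs) (\<lambda>i. of_nat (vertex_degree G (vs ! i)))"

definition inverse_degree_matrix :: "('v, 'e) hypergraph \<Rightarrow> 'v list \<Rightarrow> complex mat" where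
  "inverse_degree_matrix G vs =
     mat_diag (length vs) (\<lambda>i. inverse (of_nat (vertex_degree G (vs ! i))))"

definition kirchhoff_laplacian :: "('v, 'e) hypergraph \<Rightarrow> 'v list \<Rightarrow> complex mat" where
  "kirchhoff_laplacian G vs = degree_matrix G vs - adjacency_matrix G vs"

definition normalized_laplacian :: "('v, 'e) hypergraph \<Rightarrow> 'v list \<Rightarrow> complex mat" where
  "normalized_laplacian G vs =
     1\<^sub>m (length vs) - inverse_degree_matrix G vs * adjacency_matrix G vs"

text \<open>The \<open>k\<close>-th smallest eigenvalue, for \<open>1 \<le> k \<le> n\<close>, of an \<open>n \<times> n\<close> matrix all of whose
  eigenvalues are real, counted with algebraic multiplicity. For such matrices \<open>Re\<close> is only
  the coercion of the roots of the characteristic polynomial to the reals. List indices start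
  at 0, hence the shift.\<close>

definition ordered_eigenvalue :: "nat \<Rightarrow> complex mat \<Rightarrow> real" where
  "ordered_eigenvalue k M =
     sorted_list_of_multiset (image_mset Re (proots (char_poly M))) ! (k - 1)"

definition weak_deletion :: "'v \<Rightarrow> ('v, 'e) hypergraph \<Rightarrow> ('v, 'e) hypergraph" where
  "weak_deletion v G =
     \<lparr> verts = verts G - {v},
       edges = edges G,
       incid = incid G \<inter> ((verts G - {v}) \<times> edges G),
       weight = restrict (weight G) ((verts G - {v}) \<times> edges G) \<rparr>"

definition weak_deletions :: "'v list \<Rightarrow> ('v, 'e) hypergraph \<Rightarrow> ('v, 'e) hypergraph" where
  "weak_deletions us G = fold weak_deletion us G"

lemma complex_unit_hypergraph_weak_deletion:
  assumes "complex_unit_hypergraph G"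
  shows "complex_unit_hypergraph (weak_deletion v G)"
  using assms by (auto simp: complex_unit_hypergraph_def weak_deletion_def Pi_def)

lemma adjacency_entry_hermitian:
  assumes "complex_unit_hypergraph G"
  shows "cnj (adjacency_entry G u v) = adjacency_entry G v u"
proof -
  have *: "cnj (weight G (w, e)) = inverse (weight G (w, e))"
    if "(w, e) \<in> incid G" for w e
  proof -
    have "w \<in> verts G" "e \<in> edges G"
      using assms that by (auto simp: complex_unit_hypergraph_def)
    with assms that have "norm (weight G (w, e)) = 1"
      unfolding complex_unit_hypergraph_def Pi_def by fastforce
    then show ?thesis
      by (simp add: inverse_complex_def complex_eq_iff cmod_def)
  qed
  have "(\<Sum>e\<in>common_edges G u v. cnj (edge_gain G e u v)) =
        (\<Sum>e\<in>common_edges G v u. edge_gain G e v u)"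
    by (rule sum.cong) (auto simp: common_edges_def edge_gain_def *)
  moreover have "adjacent G u v = adjacent G v u"
    by (auto simp: adjacent_def common_edges_def)
  ultimately show ?thesis
    by (simp add: adjacency_entry_def)
qed

end

theory Submission
  imports Defs "Jordan_Normal_Form.Schur_Decomposition"
begin

text \<open>Weak deletion does not change the degrees of the remaining vertices, so it turns each of the
  Hermitian matrices \<open>A\<close>, \<open>K\<close> and \<open>Id - D\<^sup>-\<^sup>1\<^sup>/\<^sup>2 A D\<^sup>-\<^sup>1\<^sup>/\<^sup>2\<close> (which is similar to \<open>L\<close>) into a
  principal submatrix, up to the order of the vertices. Such a submatrix has the form
  \<open>E\<^sup>* H E\<close> with \<open>E\<^sup>* E = 1\<close>, and the claim is Poincare separation. After diagonalizing both
  matrices one has \<open>Q\<^sup>* \<Lambda> Q = \<mu>\<close> with \<open>Q\<^sup>* Q = 1\<close>; a nonzero vector \<open>c\<close> supported on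
  the first \<open>k\<close> coordinates such that the first \<open>k - 1\<close> coordinates of \<open>Qc\<close> vanish gives
  \<open>\<lambda>\<^sub>k |c|\<^sup>2 \<le> \<Sum>\<lambda>\<^sub>i |(Qc)\<^sub>i|\<^sup>2 = \<Sum>\<mu>\<^sub>j |c\<^sub>j|\<^sup>2 \<le> \<mu>\<^sub>k |c|\<^sup>2\<close>, and the second inequality is dual.\<close>

unbundle no vec_syntax

section \<open>Unitary diagonalization of Hermitian matrices\<close>

lemma index_mat_adjoint:
  "i < dim_col A \<Longrightarrow> j < dim_row A \<Longrightarrow> mat_adjoint A $$ (i, j) = conjugate (A $$ (j, i))"
  by (simp add: mat_adjoint_def mat_of_rows_index)

lemma dim_mat_adjoint [simp]:
  "dim_row (mat_adjoint A) = dim_col A" "dim_col (mat_adjoint A) = dim_row A"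
  by (simp_all add: mat_adjoint_def)

lemma mat_adjoint_carrier [simp]: "A \<in> carrier_mat n m \<Longrightarrow> mat_adjoint A \<in> carrier_mat m n"
  by auto

lemma mat_adjoint_adjoint [simp]: "mat_adjoint (mat_adjoint A) = A"
  by (rule eq_matI) (simp_all add: index_mat_adjoint)

lemma mat_adjoint_mult:
  assumes "A \<in> carrier_mat n k" "B \<in> carrier_mat k m"
  shows "mat_adjoint (A * B) = mat_adjoint B * (mat_adjoint A :: complex mat)"
  using assms
  by (intro eq_matI) (auto simp: index_mat_adjoint scalar_prod_def mult.commute)

lemma mat_adjoint_one [simp]: "mat_adjoint (1\<^sub>m n) = (1\<^sub>m n :: complex mat)"
  by (rule eq_matI) (auto simp: index_mat_adjoint)

lemma mat_adjoint_four_block_diag: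
  fixes A :: "complex mat"
  assumes "A \<in> carrier_mat n n" "B \<in> carrier_mat m m"
  shows "mat_adjoint (four_block_mat A (0\<^sub>m n m) (0\<^sub>m m n) B)
       = four_block_mat (mat_adjoint A) (0\<^sub>m n m) (0\<^sub>m m n) (mat_adjoint B)"
  using assms by (intro eq_matI) (auto simp: index_mat_adjoint)

lemma mult_four_block_diag:
  fixes A :: "complex mat"
  assumes "A \<in> carrier_mat n n" "B \<in> carrier_mat m m" "C \<in> carrier_mat n n" "D \<in> carrier_mat m m"
  shows "four_block_mat A (0\<^sub>m n m) (0\<^sub>m m n) B * four_block_mat C (0\<^sub>m n m) (0\<^sub>m m n) D
       = four_block_mat (A * C) (0\<^sub>m n m) (0\<^sub>m m n) (B * D)"
  using assms by (subst mult_four_block_mat[where ?nr1.0=n and ?n1.0=n and ?nr2.0=m and ?n2.0=m]) auto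

text \<open>Conjugation by \<open>U\<close> followed by conjugation by \<open>W\<close> is
  conjugation by \<open>U * W\<close>. Rectangular factors are allowed, so the rule covers both
  changes of basis and compressions to subspaces.\<close>

lemma mat_adjoint_conj_mult:
  fixes H :: "complex mat"
  assumes H: "H \<in> carrier_mat n n" and U: "U \<in> carrier_mat n m" and W: "W \<in> carrier_mat m k"
  shows "mat_adjoint W * (mat_adjoint U * H * U) * W = mat_adjoint (U * W) * H * (U * W)"
proof -
  have U': "mat_adjoint U \<in> carrier_mat m n" and W': "mat_adjoint W \<in> carrier_mat k m"
    using U W by auto
  note c = H U W U' W' mult_carrier_mat[OF U' H] mult_carrier_mat[OF U W] mult_carrier_mat[OF W' U']
  have "mat_adjoint (U * W) * H * (U * W) = (mat_adjoint W * mat_adjoint U * H * U) * W"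
    unfolding mat_adjoint_mult[OF U W]
    by (rule assoc_mult_mat[OF mult_carrier_mat[OF c(8) H] U W, symmetric])
  also have "mat_adjoint W * mat_adjoint U * H = mat_adjoint W * (mat_adjoint U * H)"
    by (rule assoc_mult_mat[OF W' U' H])
  also have "\<dots> * U = mat_adjoint W * (mat_adjoint U * H * U)"
    by (rule assoc_mult_mat[OF W' c(6) U])
  finally show ?thesis by simp
qed

text \<open>One of the two inverse identities suffices for a square matrix; the other one is
  recovered in \<open>unitary_matD\<close>.\<close>

definition unitary_mat :: "nat \<Rightarrow> complex mat \<Rightarrow> bool" where
  "unitary_mat n U \<longleftrightarrow> U \<in> carrier_mat n n \<and> mat_adjoint U * U = 1\<^sub>m n"

lemma unitary_matD:
  assumes "unitary_mat n U"
  shows "U \<in> carrier_mat n n" "mat_adjoint U \<in> carrier_mat n n"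
    "mat_adjoint U * U = 1\<^sub>m n" "U * mat_adjoint U = 1\<^sub>m n"
  using assms mat_mult_left_right_inverse[of "mat_adjoint U" n U]
  by (auto simp: unitary_mat_def)

lemma unitary_mat_mult:
  assumes U: "unitary_mat n U" and V: "unitary_mat n V"
  shows "unitary_mat n (U * V)"
proof -
  note Uc = unitary_matD[OF U] and Vc = unitary_matD[OF V]
  have "mat_adjoint (U * V) * (U * V) = mat_adjoint V * (mat_adjoint U * (U * V))"
    unfolding mat_adjoint_mult[OF Uc(1) Vc(1)]
    by (rule assoc_mult_mat[OF Vc(2) Uc(2) mult_carrier_mat[OF Uc(1) Vc(1)]])
  also have "mat_adjoint U * (U * V) = V"
    using assoc_mult_mat[OF Uc(2) Uc(1) Vc(1)] Uc(3) Vc(1) by simp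
  finally show ?thesis
    using Uc(1) Vc(1,3) by (simp add: unitary_mat_def)
qed

lemma unitary_conj_similar:
  assumes U: "unitary_mat n U" and H: "H \<in> carrier_mat n n"
  shows "similar_mat (mat_adjoint U * H * U) H"
proof -
  have "similar_mat_wit (mat_adjoint U * H * U) H (mat_adjoint U) U"
    using unitary_matD[OF U] H by (intro similar_mat_witI) auto
  then show ?thesis
    by (auto simp: similar_mat_def)
qed

text \<open>Extend \<open>v\<close> to a basis, apply Gram-Schmidt, which leaves the leading vector
  alone, and divide each vector by its norm. The scalar \<open>c\<close> is the reciprocal of the
  norm of \<open>v\<close>.\<close>

lemma unitary_completion:
  fixes v :: "complex vec"
  assumes v: "v \<in> carrier_vec n" "v \<noteq> 0\<^sub>v n"
  shows "\<exists>U c. unitary_mat n U \<and> c \<noteq> 0 \<and> col U 0 = c \<cdot>\<^sub>v v"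
proof -
  interpret cof_vec_space n "TYPE(complex)" .
  define ws where "ws = gram_schmidt n (basis_completion v)"
  have len0: "length (basis_completion v) = n" and hd0: "hd (basis_completion v) = v"
    using basis_completion[OF v] by auto
  have n: "n > 0"
    using v by (cases n) auto
  have ws: "corthogonal ws" "set ws \<subseteq> carrier_vec n" "length ws = n"
    using gram_schmidt_result[OF basis_completion(2,4,5)[OF v] ws_def] len0 by auto
  have "basis_completion v = v # tl (basis_completion v)"
    using len0 hd0 n by (cases "basis_completion v") auto
  then have "hd ws = v"
    using gram_schmidt_hd[OF v(1), of "tl (basis_completion v)"] by (simp add: ws_def)
  then have ws0: "ws ! 0 = v"
    using ws(3) n by (cases ws) auto
  \<comment> \<open>\<open>q j\<close> is the squared norm of the \<open>j\<close>-th orthogonal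
    vector. Gram-Schmidt yields orthogonal nonzero vectors that are not normalized, whence the
    division by \<open>sqrt (q j)\<close> in \<open>U\<close>.\<close>
  define q where "q j = (\<Sum>k<n. (cmod (ws ! j $ k))\<^sup>2)" for j
  have carr: "ws ! j \<in> carrier_vec n" if "j < n" for j
    using ws(2,3) that by auto
  have ip: "ws ! i \<bullet>c ws ! j = (\<Sum>k<n. ws ! i $ k * cnj (ws ! j $ k))" if "i < n" "j < n" for i j
    using carr[OF that(1)] carr[OF that(2)] by (simp add: scalar_prod_def atLeast0LessThan)
  have ipq: "ws ! j \<bullet>c ws ! j = of_real (q j)" if "j < n" for j
    unfolding ip[OF that that] q_def by (simp only: of_real_sum complex_norm_square)
  have qpos: "q j > 0" if "j < n" for j
  proof -
    have "q j \<noteq> 0"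
      using corthogonalD[OF ws(1), of j j] ipq[OF that] ws(3) that by auto
    moreover have "q j \<ge> 0"
      by (simp add: q_def sum_nonneg)
    ultimately show ?thesis by simp
  qed
  define U where "U = Matrix.mat n n (\<lambda>(i, j). ws ! j $ i / of_real (sqrt (q j)))"
  have "mat_adjoint U * U = 1\<^sub>m n"
  proof (rule eq_matI)
    fix i j
    assume "i < dim_row (1\<^sub>m n :: complex mat)" "j < dim_col (1\<^sub>m n :: complex mat)"
    then have ij: "i < n" "j < n" by auto
    have "(mat_adjoint U * U) $$ (i, j)
        = (\<Sum>k<n. ws ! j $ k * cnj (ws ! i $ k) / (of_real (sqrt (q j)) * of_real (sqrt (q i))))"
      using ij by (simp add: U_def scalar_prod_def index_mat_adjoint atLeast0LessThan mult_ac)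
    also have "\<dots> = (ws ! j \<bullet>c ws ! i) / (of_real (sqrt (q j)) * of_real (sqrt (q i)))"
      by (simp add: ip ij sum_divide_distrib)
    also have "\<dots> = (1\<^sub>m n) $$ (i, j)"
    proof (cases "i = j")
      case True
      have "sqrt (q j) * sqrt (q j) = q j"
        using qpos[OF ij(2)] by simp
      then have "of_real (sqrt (q j)) * of_real (sqrt (q j)) = (of_real (q j) :: complex)"
        by (metis of_real_mult)
      then show ?thesis
        using True ij qpos[OF ij(2)] by (simp add: ipq)
    next
      case False
      then show ?thesis
        using corthogonalD[OF ws(1), of j i] ij ws(3) by auto
    qed
    finally show "(mat_adjoint U * U) $$ (i, j) = (1\<^sub>m n) $$ (i, j)" .
  qed (auto simp: U_def)
  then have "unitary_mat n U"
    by (simp add: unitary_mat_def U_def)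
  moreover have "col U 0 = of_real (1 / sqrt (q 0)) \<cdot>\<^sub>v v"
    using n v ws0 by (intro eq_vecI) (auto simp: U_def)
  moreover have "(of_real (1 / sqrt (q 0)) :: complex) \<noteq> 0"
    using qpos[OF n] by simp
  ultimately show ?thesis by blast
qed

definition hermitian_mat :: "nat \<Rightarrow> complex mat \<Rightarrow> bool" where
  "hermitian_mat n H \<longleftrightarrow> H \<in> carrier_mat n n \<and> mat_adjoint H = H"

lemma hermitian_mat_conj:
  assumes "hermitian_mat n H" "E \<in> carrier_mat n m"
  shows "hermitian_mat m (mat_adjoint E * H * E)"
proof -
  have H: "H \<in> carrier_mat n n" "mat_adjoint H = H"
    using assms by (auto simp: hermitian_mat_def)
  have "mat_adjoint (mat_adjoint E * H * E) = mat_adjoint E * (H * E)"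
    using H(2) assms(2)
    by (simp add: mat_adjoint_mult[OF mult_carrier_mat[OF mat_adjoint_carrier H(1)]]
        mat_adjoint_mult[OF mat_adjoint_carrier H(1)])
  also have "\<dots> = mat_adjoint E * H * E"
    using H assms(2) by (intro assoc_mult_mat[symmetric]) auto
  finally show ?thesis
    using H assms(2) by (auto simp: hermitian_mat_def)
qed

text \<open>Induction on the list of roots: an eigenvector for the first root becomes the first
  basis vector, Hermitian symmetry splits off a 1 by 1 block, and the remaining block has the
  remaining roots. The diagonal follows the order of whichever factorization is supplied, which
  later allows a sorted diagonal.\<close>

lemma hermitian_unitary_diag:
  assumes "hermitian_mat n H" and "char_poly H = (\<Prod>e\<leftarrow>es. [:- e, 1:])"
  shows "\<exists>U. unitary_mat n U \<and> mat_adjoint U * H * U = mat_diag n (\<lambda>i. es ! i)"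
  using assms
proof (induction es arbitrary: n H)
  case Nil
  then have H: "H \<in> carrier_mat n n" by (auto simp: hermitian_mat_def)
  have "n = 0"
    using degree_monic_char_poly[OF H] Nil.prems(2) by simp
  with H have "unitary_mat n (1\<^sub>m 0) \<and> mat_adjoint (1\<^sub>m 0) * H * 1\<^sub>m 0 = mat_diag n (\<lambda>i. [] ! i)"
    by (auto simp: unitary_mat_def intro!: eq_matI simp: mat_diag_def)
  then show ?case by blast
next
  case (Cons e es)
  then have H: "H \<in> carrier_mat n n" by (auto simp: hermitian_mat_def)
  have "eigenvalue H e"
    by (simp add: eigenvalue_root_char_poly[OF H] Cons.prems(2))
  then obtain v where v: "v \<in> carrier_vec n" "v \<noteq> 0\<^sub>v n" "H *\<^sub>v v = e \<cdot>\<^sub>v v"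
    using H by (auto simp: eigenvalue_def eigenvector_def)
  obtain m where n: "n = Suc m"
    using v by (cases n) auto
  obtain U c where U: "unitary_mat n U" and c: "c \<noteq> 0" "col U 0 = c \<cdot>\<^sub>v v"
    using unitary_completion[OF v(1,2)] by blast
  note Uc = unitary_matD[OF U]
  \<comment> \<open>In the new basis the first unit vector is an eigenvector for \<open>e\<close>,
    which determines the first column of \<open>C\<close>.\<close>
  define C where "C = mat_adjoint U * H * U"
  have hC: "hermitian_mat n C"
    unfolding C_def by (rule hermitian_mat_conj[OF Cons.prems(1) Uc(1)])
  then have C: "C \<in> carrier_mat n n" "mat_adjoint C = C"
    by (auto simp: hermitian_mat_def)
  have "col C 0 = mat_adjoint U *\<^sub>v (H *\<^sub>v col U 0)"
  proof -
    have "C = mat_adjoint U * (H * U)"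
      unfolding C_def by (rule assoc_mult_mat[OF Uc(2) H Uc(1)])
    moreover have "0 < n" by (simp add: n)
    ultimately show ?thesis
      by (simp only: col_mult2[OF Uc(2) mult_carrier_mat[OF H Uc(1)]] col_mult2[OF H Uc(1)])
  qed
  also have "H *\<^sub>v col U 0 = e \<cdot>\<^sub>v col U 0"
    using v c H by (simp add: mult_mat_vec[OF H v(1)] smult_smult_assoc mult.commute)
  also have "mat_adjoint U *\<^sub>v (e \<cdot>\<^sub>v col U 0) = e \<cdot>\<^sub>v col (mat_adjoint U * U) 0"
  proof -
    have "0 < n" by (simp add: n)
    moreover have "col U 0 \<in> carrier_vec n" using Uc(1) by auto
    ultimately show ?thesis
      by (simp only: mult_mat_vec[OF Uc(2)] col_mult2[OF Uc(2) Uc(1)])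
  qed
  finally have col0: "col C 0 = e \<cdot>\<^sub>v unit_vec n 0"
    using Uc(3) n by simp
  have C0: "C $$ (i, 0) = (if i = 0 then e else 0)" if "i < n" for i
    using arg_cong[OF col0, of "\<lambda>w. w $ i"] that C n by (auto simp: unit_vec_def)
  \<comment> \<open>Hermitian symmetry carries the zeros of the first column over to the first row,
    so \<open>C\<close> is block diagonal and not merely block triangular.\<close>
  have C0': "C $$ (0, i) = (if i = 0 then e else 0)" if "i < n" for i
  proof -
    have "C $$ (0, i) = cnj (C $$ (i, 0))"
      using C n that by (metis carrier_matD(1,2) conjugate_complex_def index_mat_adjoint zero_less_Suc)
    then show ?thesis
      using C0[OF that] C0[of 0] n that by auto
  qed
  define D where "D = Matrix.mat m m (\<lambda>(i, j). C $$ (Suc i, Suc j))"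
  have D: "D \<in> carrier_mat m m" by (simp add: D_def)
  define E1 where "E1 = Matrix.mat 1 1 (\<lambda>_. e)"
  have E1: "E1 \<in> carrier_mat 1 1" by (simp add: E1_def)
  have Cblock: "C = four_block_mat E1 (0\<^sub>m 1 m) (0\<^sub>m m 1) D"
    using C n by (intro eq_matI) (auto simp: E1_def D_def C0 C0')
  have "mat_adjoint D = D"
  proof (rule eq_matI)
    fix i j assume "i < dim_row D" "j < dim_col D"
    then have ij: "i < m" "j < m" by (auto simp: D_def)
    have "cnj (C $$ (Suc j, Suc i)) = C $$ (Suc i, Suc j)"
      using C n ij by (metis Suc_mono carrier_matD(1,2) conjugate_complex_def index_mat_adjoint)
    then show "mat_adjoint D $$ (i, j) = D $$ (i, j)"
      using ij by (simp add: D_def index_mat_adjoint)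
  qed (auto simp: D_def)
  with D have hD: "hermitian_mat m D" by (simp add: hermitian_mat_def)
  \<comment> \<open>The factor belonging to \<open>e\<close> is cancelled from both sides, leaving
    for \<open>D\<close> the factorization that the induction hypothesis requires.\<close>
  have "[:- e, 1:] * (\<Prod>e\<leftarrow>es. [:- e, 1:]) = char_poly C"
    using char_poly_similar[OF unitary_conj_similar[OF U H]] Cons.prems(2) by (simp add: C_def)
  also have "\<dots> = char_poly E1 * char_poly D"
    unfolding Cblock by (rule char_poly_four_block_zeros_col[OF E1 _ D]) simp
  also have "char_poly E1 = [:- e, 1:]"
    by (simp add: E1_def char_poly_defs Determinant.det_def sign_def)
  finally have "char_poly D = (\<Prod>e\<leftarrow>es. [:- e, 1:])"
    by (metis mult_cancel_left pCons_eq_0_iff zero_neq_one)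
  from Cons.IH[OF hD this] obtain V where V: "unitary_mat m V"
    and Vd: "mat_adjoint V * D * V = mat_diag m (\<lambda>i. es ! i)" by blast
  note Vc = unitary_matD[OF V]
  \<comment> \<open>\<open>W\<close> diagonalizes the block \<open>D\<close> and fixes the
    eigenvector already split off.\<close>
  define W where "W = four_block_mat (1\<^sub>m 1) (0\<^sub>m 1 m) (0\<^sub>m m 1) V"
  have W: "W \<in> carrier_mat n n"
    using Vc(1) by (auto simp: W_def n)
  have W': "mat_adjoint W = four_block_mat (1\<^sub>m 1) (0\<^sub>m 1 m) (0\<^sub>m m 1) (mat_adjoint V)"
    unfolding W_def using mat_adjoint_four_block_diag[OF one_carrier_mat Vc(1)] by simp
  have "mat_adjoint W * W = four_block_mat (1\<^sub>m 1) (0\<^sub>m 1 m) (0\<^sub>m m 1) (1\<^sub>m m)"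
    unfolding W' unfolding W_def
    by (subst mult_four_block_diag) (use Vc in auto)
  then have uW: "unitary_mat n W"
    using W by (simp add: unitary_mat_def n)
  have "mat_adjoint W * C * W = four_block_mat E1 (0\<^sub>m 1 m) (0\<^sub>m m 1) (mat_adjoint V * D * V)"
    unfolding W' Cblock unfolding W_def
    by (subst mult_four_block_diag, (use Vc E1 D in auto)[4])+ (use E1 in simp)
  also have "\<dots> = mat_diag n (\<lambda>i. (e # es) ! i)"
    unfolding Vd by (rule eq_matI) (auto simp: E1_def mat_diag_def n nth_Cons')
  finally have "mat_adjoint W * C * W = mat_diag n (\<lambda>i. (e # es) ! i)" .
  moreover have "mat_adjoint W * C * W = mat_adjoint (U * W) * H * (U * W)"
    unfolding C_def by (rule mat_adjoint_conj_mult[OF H Uc(1) W])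
  ultimately show ?case
    using unitary_mat_mult[OF U uW] by metis
qed

section \<open>The ordered spectrum of a Hermitian matrix\<close>

definition spectrum_list :: "complex mat \<Rightarrow> real list" where
  "spectrum_list M = sorted_list_of_multiset (image_mset Re (proots (char_poly M)))"

lemma ordered_eigenvalue_conv_spectrum_list: "ordered_eigenvalue k M = spectrum_list M ! (k - 1)"
  by (simp add: ordered_eigenvalue_def spectrum_list_def)

text \<open>The matrix is diagonalized twice. An arbitrary factorization of the characteristic
  polynomial shows that all roots are real, so that \<open>Re\<close> loses nothing; the sorted list
  of real parts is then itself a factorization, and the second diagonalization follows its
  order.\<close>

lemma hermitian_spectral:
  assumes H: "hermitian_mat n H"
  shows "length (spectrum_list H) = n"
    and "\<exists>U. unitary_mat n U \<and> mat_adjoint U * H * U = mat_diag n (\<lambda>i. of_real (spectrum_list H ! i))"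
proof -
  have Hc: "H \<in> carrier_mat n n" using H by (simp add: hermitian_mat_def)
  obtain es where es: "char_poly H = (\<Prod>e\<leftarrow>es. [:- e, 1:])" "length es = n"
    using char_poly_factorized[OF Hc] by blast
  obtain U where U: "unitary_mat n U" "mat_adjoint U * H * U = mat_diag n (\<lambda>i. es ! i)"
    using hermitian_unitary_diag[OF H es(1)] by blast
  have hD: "hermitian_mat n (mat_diag n (\<lambda>i. es ! i))"
    using hermitian_mat_conj[OF H unitary_matD(1)[OF U(1)]] U(2) by simp
  \<comment> \<open>A diagonal matrix that is Hermitian has self-conjugate entries.\<close>
  have real: "complex_of_real (Re e) = e" if e: "e \<in> set es" for e
  proof -
    obtain i where i: "i < n" "e = es ! i"
      using e es(2) by (metis in_set_conv_nth)
    have "mat_adjoint (mat_diag n (\<lambda>i. es ! i)) $$ (i, i) = mat_diag n (\<lambda>i. es ! i) $$ (i, i)"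
      using hD by (simp add: hermitian_mat_def)
    then have "cnj e = e"
      using i by (simp add: index_mat_adjoint mat_diag_def)
    then show ?thesis
      by (simp add: complex_eq_iff)
  qed
  have "proots (char_poly H) = mset es"
    unfolding es(1)
  proof (induction es)
    case (Cons a es)
    have "(\<Prod>e\<leftarrow>es. [:- e, 1:]) \<noteq> 0"
      by (auto simp: prod_list_zero_iff)
    then show ?case
      using Cons.IH by (simp add: proots_mult del: mult_pCons_left)
  qed simp
  then have ms: "mset (spectrum_list H) = image_mset Re (mset es)"
    by (simp add: spectrum_list_def)
  then show "length (spectrum_list H) = n"
    using es(2) by (metis mset_map length_map size_mset)
  have "mset (map complex_of_real (spectrum_list H)) = image_mset (\<lambda>e. complex_of_real (Re e)) (mset es)"
    by (simp add: ms multiset.map_comp o_def)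
  also have "\<dots> = image_mset (\<lambda>e. e) (mset es)"
    by (intro image_mset_cong) (simp add: real)
  finally have ms': "mset (map complex_of_real (spectrum_list H)) = mset es"
    by simp
  have "mset (map (\<lambda>e. [:- e, 1:]) (map complex_of_real (spectrum_list H))) = mset (map (\<lambda>e. [:- e, 1:]) es)"
    by (simp only: mset_map ms'[unfolded mset_map])
  \<comment> \<open>The two lists of roots are permutations of each other, so the products of their
    linear factors agree.\<close>
  then have "char_poly H = (\<Prod>e\<leftarrow>map complex_of_real (spectrum_list H). [:- e, 1:])"
    unfolding es(1) by (metis prod_mset_prod_list)
  from hermitian_unitary_diag[OF H this] obtain V where V: "unitary_mat n V"
    "mat_adjoint V * H * V = mat_diag n (\<lambda>i. map complex_of_real (spectrum_list H) ! i)" by blast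
  moreover have "mat_diag n (\<lambda>i. map complex_of_real (spectrum_list H) ! i)
      = mat_diag n (\<lambda>i. of_real (spectrum_list H ! i))"
    using \<open>length (spectrum_list H) = n\<close> by (intro eq_matI) (auto simp: mat_diag_def)
  ultimately show "\<exists>U. unitary_mat n U \<and>
      mat_adjoint U * H * U = mat_diag n (\<lambda>i. of_real (spectrum_list H ! i))"
    by metis
qed

section \<open>Poincare separation\<close>

text \<open>A zero row makes the determinant vanish, since the transpose kills a unit vector. This
  serves as the dimension count: \<open>m - 1\<close> homogeneous conditions on \<open>m\<close>
  unknowns, padded with a zero row to a square system, have a nonzero solution.\<close>

lemma zero_row_kernel:
  fixes T :: "complex mat"
  assumes T: "T \<in> carrier_mat m m" and k: "k < m" and zero: "\<And>j. j < m \<Longrightarrow> T $$ (k, j) = 0"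
  obtains c where "c \<in> carrier_vec m" "c \<noteq> 0\<^sub>v m" "T *\<^sub>v c = 0\<^sub>v m"
proof -
  have "transpose_mat T *\<^sub>v unit_vec m k = 0\<^sub>v m"
    using T k zero by (intro eq_vecI) auto
  moreover have "(unit_vec m k :: complex vec) \<noteq> 0\<^sub>v m"
    using k by simp
  ultimately have "Determinant.det (transpose_mat T) = 0"
    using det_0_iff_vec_prod_zero[OF transpose_carrier_mat[THEN iffD2, OF T]] unit_vec_carrier by blast
  then have "Determinant.det T = 0"
    using Determinant.det_transpose[OF T] by simp
  then show thesis
    using det_0_iff_vec_prod_zero[OF T] that by blast
qed

text \<open>Both sides are the value at \<open>c\<close> of one quadratic form, given by
  \<open>mat_adjoint Q * diag(a) * Q\<close> on the left and by \<open>diag(b)\<close> on the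
  right.\<close>

lemma diag_form_transfer:
  fixes a b :: "nat \<Rightarrow> real" and Q :: "complex mat"
  assumes Q: "Q \<in> carrier_mat n m" and c: "c \<in> carrier_vec m"
    and eq: "mat_adjoint Q * mat_diag n (\<lambda>i. of_real (a i)) * Q = mat_diag m (\<lambda>j. of_real (b j))"
  shows "(\<Sum>i<n. a i * (cmod ((Q *\<^sub>v c) $ i))\<^sup>2) = (\<Sum>j<m. b j * (cmod (c $ j))\<^sup>2)"
proof -
  have ent: "(\<Sum>i<n. cnj (Q $$ (i, l)) * of_real (a i) * Q $$ (i, j)) = (if l = j then of_real (b j) else 0)"
    if "l < m" "j < m" for l j
  proof -
    have "(mat_adjoint Q * mat_diag n (\<lambda>i. of_real (a i)) * Q) $$ (l, j)
        = (\<Sum>i<n. cnj (Q $$ (i, l)) * of_real (a i) * Q $$ (i, j))"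
      using Q that by (subst mat_diag_mult_right[of _ m])
        (auto simp: scalar_prod_def index_mat_adjoint atLeast0LessThan)
    then show ?thesis
      unfolding eq using that by (simp add: mat_diag_def)
  qed
  have y: "(Q *\<^sub>v c) $ i = (\<Sum>j<m. Q $$ (i, j) * c $ j)" if "i < n" for i
    using Q c that by (simp add: scalar_prod_def atLeast0LessThan)
  have "complex_of_real (\<Sum>i<n. a i * (cmod ((Q *\<^sub>v c) $ i))\<^sup>2)
      = (\<Sum>i<n. of_real (a i) * ((Q *\<^sub>v c) $ i * cnj ((Q *\<^sub>v c) $ i)))"
    by (simp only: of_real_sum of_real_mult complex_norm_square)
  also have "\<dots> = (\<Sum>i<n. \<Sum>j<m. \<Sum>l<m. c $ j * cnj (c $ l) * (cnj (Q $$ (i, l)) * of_real (a i) * Q $$ (i, j)))"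
  proof (intro sum.cong refl)
    fix i assume "i \<in> {..<n}"
    then have "(Q *\<^sub>v c) $ i = (\<Sum>j<m. Q $$ (i, j) * c $ j)" by (simp add: y)
    then show "of_real (a i) * ((Q *\<^sub>v c) $ i * cnj ((Q *\<^sub>v c) $ i))
        = (\<Sum>j<m. \<Sum>l<m. c $ j * cnj (c $ l) * (cnj (Q $$ (i, l)) * of_real (a i) * Q $$ (i, j)))"
      unfolding cnj_sum sum_product sum_distrib_left
      by (simp only: cnj_sum sum_product) (simp add: sum_distrib_left mult_ac)
  qed
  \<comment> \<open>With the sum over \<open>i\<close> innermost, it becomes the
    \<open>(l, j)\<close> entry computed in \<open>ent\<close>, which vanishes off the
    diagonal.\<close>
  also have "\<dots> = (\<Sum>j<m. \<Sum>l<m. \<Sum>i<n. c $ j * cnj (c $ l) * (cnj (Q $$ (i, l)) * of_real (a i) * Q $$ (i, j)))"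
    by (subst sum.swap) (intro sum.cong refl sum.swap)
  also have "\<dots> = (\<Sum>j<m. \<Sum>l<m. c $ j * cnj (c $ l) * (if l = j then of_real (b j) else 0))"
    by (intro sum.cong refl) (simp only: sum_distrib_left[symmetric] ent lessThan_iff)
  also have "\<dots> = (\<Sum>j<m. of_real (b j) * (c $ j * cnj (c $ j)))"
    by (intro sum.cong refl) (simp add: if_distrib cong: if_cong)
  also have "\<dots> = of_real (\<Sum>j<m. b j * (cmod (c $ j))\<^sup>2)"
    by (simp only: of_real_sum of_real_mult complex_norm_square)
  finally show ?thesis
    by (simp only: of_real_eq_iff)
qed

text \<open>For each inequality, \<open>m - 1\<close> conditions on a nonzero vector
  \<open>c\<close> confine the relevant indices to the right side of \<open>k\<close> in one list
  and of \<open>k\<close> or \<open>k + r\<close> in the other. Indices are zero-based here: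
  \<open>k\<close> is the position of eigenvalue number \<open>k + 1\<close>.\<close>

lemma diag_separation:
  fixes a b :: "nat \<Rightarrow> real" and Q :: "complex mat"
  assumes Q: "Q \<in> carrier_mat (m + r) m" and iso: "mat_adjoint Q * Q = 1\<^sub>m m"
    and eq: "mat_adjoint Q * mat_diag (m + r) (\<lambda>i. of_real (a i)) * Q = mat_diag m (\<lambda>j. of_real (b j))"
    and a: "\<And>i j. i \<le> j \<Longrightarrow> j < m + r \<Longrightarrow> a i \<le> a j"
    and b: "\<And>i j. i \<le> j \<Longrightarrow> j < m \<Longrightarrow> b i \<le> b j"
    and k: "k < m"
  shows "a k \<le> b k" and "b k \<le> a (k + r)"
proof -
  let ?y = "\<lambda>c i. (cmod ((Q *\<^sub>v c) $ i))\<^sup>2"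
  \<comment> \<open>With all weights equal to 1 the transfer of forms says that \<open>Q\<close>
    preserves norms.\<close>
  have Qi: "mat_adjoint Q * mat_diag (m + r) (\<lambda>i. of_real 1) * Q = mat_diag m (\<lambda>j. of_real 1)"
    using Q iso by (simp add: right_mult_one_mat[where nr=m])
  have norm: "(\<Sum>i<m + r. ?y c i) = (\<Sum>j<m. (cmod (c $ j))\<^sup>2)" if "c \<in> carrier_vec m" for c
    using diag_form_transfer[OF Q that Qi] by simp
  note form = diag_form_transfer[OF Q _ eq]
  have pos: "(\<Sum>j<m. (cmod (c $ j))\<^sup>2) > 0" if c: "c \<in> carrier_vec m" "c \<noteq> 0\<^sub>v m" for c :: "complex vec"
  proof -
    obtain j where "j < m" "c $ j \<noteq> 0"
      using c by (metis carrier_vecD eq_vecI index_zero_vec)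
    then show ?thesis
      by (intro sum_pos2[of _ j]) auto
  qed
  show "a k \<le> b k"
  proof -
    txt \<open>A square system: row \<open>i < k\<close> forces \<open>(Qc)\<^sub>i = 0\<close>, row \<open>i > k\<close> forces \<open>c\<^sub>i = 0\<close>, and the
      zero row \<open>k\<close> yields a nontrivial solution.\<close>
    define T where "T = Matrix.mat m m (\<lambda>(i, j). if i = k then 0 else
      if i < k then Q $$ (i, j) else if i = j then 1 else 0)"
    have T: "T \<in> carrier_mat m m" "\<And>j. j < m \<Longrightarrow> T $$ (k, j) = 0"
      using k by (simp_all add: T_def)
    obtain c where c: "c \<in> carrier_vec m" "c \<noteq> 0\<^sub>v m" "T *\<^sub>v c = 0\<^sub>v m"
      using zero_row_kernel[OF T(1) k T(2)] .
    have Tc: "(\<Sum>j<m. T $$ (i, j) * c $ j) = 0" if "i < m" for i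
      using arg_cong[OF c(3), of "\<lambda>w. w $ i"] that c(1) T(1)
      by (simp add: scalar_prod_def atLeast0LessThan)
    have y0: "(Q *\<^sub>v c) $ i = 0" if "i < k" for i
      using Tc[of i] that k Q c(1) by (simp add: T_def scalar_prod_def atLeast0LessThan)
    have c0: "c $ i = 0" if "k < i" "i < m" for i
      using Tc[of i] that by (simp add: T_def if_distrib[where f="\<lambda>x. x * _"] cong: if_cong)
    have "a k * (\<Sum>j<m. (cmod (c $ j))\<^sup>2) = (\<Sum>i<m + r. a k * ?y c i)"
      by (simp add: norm[OF c(1)] flip: sum_distrib_left)
    also have "\<dots> \<le> (\<Sum>i<m + r. a i * ?y c i)"
    proof (rule sum_mono)
      fix i assume "i \<in> {..<m + r}"
      then show "a k * ?y c i \<le> a i * ?y c i"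
        using y0[of i] a[of k i] by (cases "i < k") (auto intro: mult_right_mono)
    qed
    also have "\<dots> = (\<Sum>j<m. b j * (cmod (c $ j))\<^sup>2)"
      by (rule form[OF c(1)])
    also have "\<dots> \<le> (\<Sum>j<m. b k * (cmod (c $ j))\<^sup>2)"
    proof (rule sum_mono)
      fix j assume "j \<in> {..<m}"
      then show "b j * (cmod (c $ j))\<^sup>2 \<le> b k * (cmod (c $ j))\<^sup>2"
        using c0[of j] b[of j k] k by (cases "k < j") (auto intro: mult_right_mono)
    qed
    finally show ?thesis
      using pos[OF c(1,2)] by (simp flip: sum_distrib_left)
  qed
  show "b k \<le> a (k + r)"
  proof -
    \<comment> \<open>The dual system: row \<open>i < k\<close> forces the coordinate
      \<open>c $ i\<close> to vanish, row \<open>i > k\<close> forces coordinate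
      \<open>i + r\<close> of \<open>Qc\<close> to vanish, and row \<open>k\<close> is again zero.
      Hence only coordinates up to \<open>k + r\<close> of \<open>Qc\<close> survive.\<close>
    define T where "T = Matrix.mat m m (\<lambda>(i, j). if i = k then 0 else
      if i < k then if i = j then 1 else 0 else Q $$ (i + r, j))"
    have T: "T \<in> carrier_mat m m" "\<And>j. j < m \<Longrightarrow> T $$ (k, j) = 0"
      using k by (simp_all add: T_def)
    obtain c where c: "c \<in> carrier_vec m" "c \<noteq> 0\<^sub>v m" "T *\<^sub>v c = 0\<^sub>v m"
      using zero_row_kernel[OF T(1) k T(2)] .
    have Tc: "(\<Sum>j<m. T $$ (i, j) * c $ j) = 0" if "i < m" for i
      using arg_cong[OF c(3), of "\<lambda>w. w $ i"] that c(1) T(1)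
      by (simp add: scalar_prod_def atLeast0LessThan)
    have y0: "(Q *\<^sub>v c) $ i = 0" if "k + r < i" "i < m + r" for i
    proof -
      have i: "i - r < m" "i - r \<noteq> k" "\<not> i - r < k" "i - r + r = i"
        using that by auto
      show ?thesis
        using Tc[OF i(1)] i that Q c(1) by (simp add: T_def scalar_prod_def atLeast0LessThan)
    qed
    have c0: "c $ i = 0" if "i < k" for i
      using Tc[of i] that k by (simp add: T_def if_distrib[where f="\<lambda>x. x * _"] cong: if_cong)
    have "b k * (\<Sum>j<m. (cmod (c $ j))\<^sup>2) = (\<Sum>j<m. b k * (cmod (c $ j))\<^sup>2)"
      by (simp add: sum_distrib_left)
    also have "\<dots> \<le> (\<Sum>j<m. b j * (cmod (c $ j))\<^sup>2)"
    proof (rule sum_mono)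
      fix j assume "j \<in> {..<m}"
      then show "b k * (cmod (c $ j))\<^sup>2 \<le> b j * (cmod (c $ j))\<^sup>2"
        using c0[of j] b[of k j] by (cases "j < k") (auto intro: mult_right_mono)
    qed
    also have "\<dots> = (\<Sum>i<m + r. a i * ?y c i)"
      by (rule form[OF c(1), symmetric])
    also have "\<dots> \<le> (\<Sum>i<m + r. a (k + r) * ?y c i)"
    proof (rule sum_mono)
      fix i assume "i \<in> {..<m + r}"
      then show "a i * ?y c i \<le> a (k + r) * ?y c i"
        using y0[of i] a[of i "k + r"] k by (cases "k + r < i") (auto intro: mult_right_mono)
    qed
    also have "\<dots> = a (k + r) * (\<Sum>j<m. (cmod (c $ j))\<^sup>2)"
      by (simp add: norm[OF c(1)] flip: sum_distrib_left)
    finally show ?thesis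
      using pos[OF c(1,2)] by simp
  qed
qed

theorem poincare_separation:
  assumes H: "hermitian_mat (m + r) H"
    and E: "E \<in> carrier_mat (m + r) m" "mat_adjoint E * E = 1\<^sub>m m"
    and k: "k \<in> {1..m}"
  shows "ordered_eigenvalue k H \<le> ordered_eigenvalue k (mat_adjoint E * H * E)"
    and "ordered_eigenvalue k (mat_adjoint E * H * E) \<le> ordered_eigenvalue (k + r) H"
proof -
  define B where "B = mat_adjoint E * H * E"
  have hB: "hermitian_mat m B"
    unfolding B_def by (rule hermitian_mat_conj[OF H E(1)])
  have Hc: "H \<in> carrier_mat (m + r) (m + r)" and Bc: "B \<in> carrier_mat m m"
    using H hB by (auto simp: hermitian_mat_def)
  let ?L = "mat_diag (m + r) (\<lambda>i. complex_of_real (spectrum_list H ! i))"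
  obtain U where U: "unitary_mat (m + r) U" and UH: "mat_adjoint U * H * U = ?L"
    using hermitian_spectral(2)[OF H] by blast
  obtain W where W: "unitary_mat m W"
    and WB: "mat_adjoint W * B * W = mat_diag m (\<lambda>i. of_real (spectrum_list B ! i))"
    using hermitian_spectral(2)[OF hB] by blast
  note Uc = unitary_matD[OF U] and Wc = unitary_matD[OF W]
  \<comment> \<open>\<open>Q\<close> is the isometry \<open>E\<close> written in the eigenbases of
    \<open>B\<close> and \<open>H\<close>.\<close>
  define Q where "Q = mat_adjoint U * (E * W)"
  have EW: "E * W \<in> carrier_mat (m + r) m"
    using E(1) Wc(1) by auto
  have Q: "Q \<in> carrier_mat (m + r) m"
    unfolding Q_def by (rule mult_carrier_mat[OF Uc(2) EW])
  have UQ: "U * Q = E * W"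
    unfolding Q_def using assoc_mult_mat[OF Uc(1,2) EW] by (simp only: Uc(4) left_mult_one_mat[OF EW])
  have Qadj: "mat_adjoint Q = mat_adjoint (E * W) * U"
    unfolding Q_def by (simp add: mat_adjoint_mult[OF Uc(2) EW])
  have "mat_adjoint Q * Q = mat_adjoint (E * W) * (U * Q)"
    unfolding Qadj by (rule assoc_mult_mat[OF mat_adjoint_carrier[OF EW] Uc(1) Q])
  \<comment> \<open>An identity matrix is inserted so that the conjugation rule applies with
    \<open>1\<close> in place of \<open>H\<close>.\<close>
  also have "\<dots> = mat_adjoint (E * W) * 1\<^sub>m (m + r) * (E * W)"
    unfolding UQ by (simp add: right_mult_one_mat[OF mat_adjoint_carrier[OF EW]])
  also have "\<dots> = mat_adjoint W * (mat_adjoint E * 1\<^sub>m (m + r) * E) * W"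
    by (rule mat_adjoint_conj_mult[OF one_carrier_mat E(1) Wc(1), symmetric])
  also have "\<dots> = 1\<^sub>m m"
    using right_mult_one_mat[OF mat_adjoint_carrier[OF E(1)]] right_mult_one_mat[OF Wc(2)] E(2) Wc(3)
    by simp
  finally have iso: "mat_adjoint Q * Q = 1\<^sub>m m" .
  have "mat_adjoint Q * ?L * Q = mat_adjoint (U * Q) * H * (U * Q)"
    unfolding UH[symmetric] by (rule mat_adjoint_conj_mult[OF Hc Uc(1) Q])
  also have "\<dots> = mat_adjoint W * B * W"
    unfolding UQ B_def by (rule mat_adjoint_conj_mult[OF Hc E(1) Wc(1), symmetric])
  finally have eq: "mat_adjoint Q * ?L * Q = mat_diag m (\<lambda>i. of_real (spectrum_list B ! i))"
    by (simp only: WB)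
  have sH: "spectrum_list H ! i \<le> spectrum_list H ! j" if "i \<le> j" "j < m + r" for i j
    using that hermitian_spectral(1)[OF H] by (intro sorted_nth_mono) (auto simp: spectrum_list_def)
  have sB: "spectrum_list B ! i \<le> spectrum_list B ! j" if "i \<le> j" "j < m" for i j
    using that hermitian_spectral(1)[OF hB] by (intro sorted_nth_mono) (auto simp: spectrum_list_def)
  \<comment> \<open>Passage to zero-based positions; \<open>k \<ge> 1\<close> makes the truncated
    subtraction harmless.\<close>
  have k': "k - 1 < m" "k + r - 1 = k - 1 + r" using k by auto
  show "ordered_eigenvalue k H \<le> ordered_eigenvalue k (mat_adjoint E * H * E)"
    and "ordered_eigenvalue k (mat_adjoint E * H * E) \<le> ordered_eigenvalue (k + r) H"
    using diag_separation[OF Q iso eq sH sB k'(1)]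
    by (simp_all only: ordered_eigenvalue_conv_spectrum_list k'(2) B_def)
qed

section \<open>Principal submatrices as compressions\<close>

text \<open>Entries depend on vertices instead of indices, so that passing to a shorter list of
  vertices yields a principal submatrix up to reordering.\<close>

definition entries_mat :: "('v \<Rightarrow> 'v \<Rightarrow> complex) \<Rightarrow> 'v list \<Rightarrow> complex mat" where
  "entries_mat h vs = Matrix.mat (length vs) (length vs) (\<lambda>(i, j). h (vs ! i) (vs ! j))"

lemma entries_mat_cong:
  assumes "\<And>u v. u \<in> set vs \<Longrightarrow> v \<in> set vs \<Longrightarrow> h u v = h' u v"
  shows "entries_mat h vs = entries_mat h' vs"
  using assms by (intro eq_matI) (auto simp: entries_mat_def)

text \<open>The smaller matrix is the compression of the larger one by a 0-1 isometry
  \<open>E\<close>, so Poincare separation applies. The two lists may order their common vertices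
  differently.\<close>

lemma entries_mat_interlacing:
  assumes herm: "\<And>u v. cnj (h u v) = h v u"
    and vs: "distinct vs" and ws: "distinct ws" "set ws \<subseteq> set vs"
    and len: "length vs = length ws + r" and k: "k \<in> {1..length ws}"
  shows "ordered_eigenvalue k (entries_mat h vs) \<le> ordered_eigenvalue k (entries_mat h ws)"
    and "ordered_eigenvalue k (entries_mat h ws) \<le> ordered_eigenvalue (k + r) (entries_mat h vs)"
proof -
  define H where "H = entries_mat h vs"
  have H: "hermitian_mat (length ws + r) H"
    unfolding hermitian_mat_def H_def
    by (auto simp: entries_mat_def len index_mat_adjoint herm intro!: eq_matI)
  have Hc: "H \<in> carrier_mat (length ws + r) (length ws + r)"
    using H by (simp add: hermitian_mat_def)
  \<comment> \<open>Column \<open>j\<close> is the unit vector at the position of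
    \<open>ws ! j\<close> in \<open>vs\<close>.\<close>
  define E :: "complex mat" where
    "E = Matrix.mat (length ws + r) (length ws) (\<lambda>(i, j). if vs ! i = ws ! j then 1 else 0)"
  have E: "E \<in> carrier_mat (length ws + r) (length ws)"
    by (simp add: E_def)
  \<comment> \<open>Exactly one position of the distinct list \<open>vs\<close> holds
    \<open>w\<close>, so the sum has a single surviving term.\<close>
  have pick: "(\<Sum>i<length ws + r. (if vs ! i = w then g (vs ! i) else 0)) = g w"
    if "w \<in> set ws" for w and g :: "'a \<Rightarrow> complex"
  proof -
    have "(\<Sum>i<length ws + r. (if vs ! i = w then g (vs ! i) else 0)) = (\<Sum>v\<in>set vs. if v = w then g v else 0)"
      using sum.reindex_bij_betw[OF bij_betw_nth[OF vs refl refl], of "\<lambda>v. if v = w then g v else 0"]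
      by (simp add: len)
    then show ?thesis
      using that ws(2) by auto
  qed
  have HE: "(H * E) $$ (i, j) = h (vs ! i) (ws ! j)" if "i < length ws + r" "j < length ws" for i j
  proof -
    have "(H * E) $$ (i, j) = (\<Sum>l<length ws + r. h (vs ! i) (vs ! l) * (if vs ! l = ws ! j then 1 else 0))"
      using that by (simp add: H_def E_def entries_mat_def len scalar_prod_def atLeast0LessThan)
    also have "\<dots> = (\<Sum>l<length ws + r. if vs ! l = ws ! j then h (vs ! i) (vs ! l) else 0)"
      by (intro sum.cong) auto
    finally show ?thesis
      using pick[of "ws ! j" "h (vs ! i)"] that by simp
  qed
  \<comment> \<open>Multiplication by the adjoint of \<open>E\<close> selects rows. A general
    \<open>X\<close> lets the fact serve both for \<open>E\<close> itself and for
    \<open>H * E\<close>.\<close>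
  have left: "(mat_adjoint E * X) $$ (j, l) = g (ws ! j)"
    if "j < length ws" "l < length ws" "X \<in> carrier_mat (length ws + r) (length ws)"
      and X: "\<And>i. i < length ws + r \<Longrightarrow> X $$ (i, l) = g (vs ! i)" for X g j l
  proof -
    have "(mat_adjoint E * X) $$ (j, l) = (\<Sum>i<length ws + r. (if vs ! i = ws ! j then 1 else 0) * X $$ (i, l))"
      using that(1-3)
      by (auto simp: E_def index_mat_adjoint scalar_prod_def atLeast0LessThan intro!: sum.cong)
    also have "\<dots> = (\<Sum>i<length ws + r. if vs ! i = ws ! j then g (vs ! i) else 0)"
      by (intro sum.cong) (auto simp: X)
    finally show ?thesis
      using pick[of "ws ! j" g] that by simp
  qed
  have iso: "mat_adjoint E * E = 1\<^sub>m (length ws)"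
  proof (rule eq_matI)
    fix j l assume "j < dim_row (1\<^sub>m (length ws) :: complex mat)" "l < dim_col (1\<^sub>m (length ws) :: complex mat)"
    then have jl: "j < length ws" "l < length ws" by auto
    have "(mat_adjoint E * E) $$ (j, l) = (if ws ! j = ws ! l then 1 else 0)"
      by (rule left[OF jl E]) (use jl in \<open>simp add: E_def\<close>)
    then show "(mat_adjoint E * E) $$ (j, l) = 1\<^sub>m (length ws) $$ (j, l)"
      using jl ws(1) by (simp add: nth_eq_iff_index_eq)
  qed (auto simp: E_def)
  have "mat_adjoint E * (H * E) = entries_mat h ws"
  proof (rule eq_matI)
    fix j l assume "j < dim_row (entries_mat h ws)" "l < dim_col (entries_mat h ws)"
    then have jl: "j < length ws" "l < length ws" by (auto simp: entries_mat_def)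
    have "(mat_adjoint E * (H * E)) $$ (j, l) = h (ws ! j) (ws ! l)"
      using left[OF jl, of "H * E" "\<lambda>v. h v (ws ! l)"] HE Hc E jl by simp
    then show "(mat_adjoint E * (H * E)) $$ (j, l) = entries_mat h ws $$ (j, l)"
      using jl by (simp add: entries_mat_def)
  qed (auto simp: E_def entries_mat_def)
  then have "mat_adjoint E * H * E = entries_mat h ws"
    by (simp add: assoc_mult_mat[OF mat_adjoint_carrier[OF E] Hc E])
  then show "ordered_eigenvalue k (entries_mat h vs) \<le> ordered_eigenvalue k (entries_mat h ws)"
    and "ordered_eigenvalue k (entries_mat h ws) \<le> ordered_eigenvalue (k + r) (entries_mat h vs)"
    using poincare_separation[OF H E iso k] by (simp_all add: H_def)
qed

section \<open>Weak vertex deletion\<close>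

text \<open>Every edge survives as a label, even if it loses a vertex, and incidences and weights at
  the other vertices stay as they were. Hence the sums over common edges and the degrees do not
  change.\<close>

lemma weak_deletion_entries:
  assumes G: "complex_unit_hypergraph G" and uv: "u \<in> verts G - {x}" "v \<in> verts G - {x}"
  shows "adjacency_entry (weak_deletion x G) u v = adjacency_entry G u v"
    and "vertex_degree (weak_deletion x G) u = vertex_degree G u"
proof -
  have ce: "common_edges (weak_deletion x G) u v = common_edges G u v"
    using uv by (auto simp: common_edges_def weak_deletion_def)
  have "edge_gain (weak_deletion x G) e u v = edge_gain G e u v" if "e \<in> common_edges G u v" for e
    using uv that by (simp add: edge_gain_def weak_deletion_def common_edges_def)
  then show "adjacency_entry (weak_deletion x G) u v = adjacency_entry G u v"
    by (simp add: adjacency_entry_def adjacent_def ce)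
  have "{e \<in> edges (weak_deletion x G). (u, e) \<in> incid (weak_deletion x G)} = {e \<in> edges G. (u, e) \<in> incid G}"
    using uv by (auto simp: weak_deletion_def)
  then show "vertex_degree (weak_deletion x G) u = vertex_degree G u"
    by (simp add: vertex_degree_def)
qed

lemma verts_weak_deletions: "verts (weak_deletions us G) = verts G - set us"
  unfolding weak_deletions_def
  by (induction us arbitrary: G) (auto simp: weak_deletion_def)

lemma weak_deletions_entries:
  assumes "complex_unit_hypergraph G" and "u \<in> verts G - set us" "v \<in> verts G - set us"
  shows "adjacency_entry (weak_deletions us G) u v = adjacency_entry G u v \<and>
    vertex_degree (weak_deletions us G) u = vertex_degree G u"
  using assms
proof (induction us arbitrary: G)
  case (Cons x us)
  have "u \<in> verts (weak_deletion x G) - set us" "v \<in> verts (weak_deletion x G) - set us"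
    using Cons.prems by (auto simp: weak_deletion_def)
  from Cons.IH[OF complex_unit_hypergraph_weak_deletion[OF Cons.prems(1)] this]
  show ?case
    using weak_deletion_entries[OF Cons.prems(1), of u x v] Cons.prems
    by (simp add: weak_deletions_def)
qed (simp add: weak_deletions_def)

section \<open>The three operators in terms of entry functions\<close>

definition kirchhoff_entry :: "('v, 'e) hypergraph \<Rightarrow> 'v \<Rightarrow> 'v \<Rightarrow> complex" where
  "kirchhoff_entry G u v = (if u = v then of_nat (vertex_degree G u) else 0) - adjacency_entry G u v"

text \<open>These are the entries of \<open>Id - D^(-1/2) A D^(-1/2)\<close>, the Hermitian stand-in
  for \<open>L\<close>, which need not be Hermitian itself.\<close>

definition sym_laplacian_entry :: "('v, 'e) hypergraph \<Rightarrow> 'v \<Rightarrow> 'v \<Rightarrow> complex" where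
  "sym_laplacian_entry G u v = (if u = v then 1 else 0) -
     adjacency_entry G u v / of_real (sqrt (vertex_degree G u) * sqrt (vertex_degree G v))"

lemma adjacency_matrix_eq_entries_mat: "adjacency_matrix G vs = entries_mat (adjacency_entry G) vs"
  by (simp add: adjacency_matrix_def entries_mat_def)

lemma kirchhoff_laplacian_eq_entries_mat:
  assumes "distinct vs"
  shows "kirchhoff_laplacian G vs = entries_mat (kirchhoff_entry G) vs"
  using assms
  by (intro eq_matI)
    (auto simp: kirchhoff_laplacian_def degree_matrix_def adjacency_matrix_def entries_mat_def
      kirchhoff_entry_def mat_diag_def nth_eq_iff_index_eq)

lemma ordered_eigenvalue_similar:
  "similar_mat A B \<Longrightarrow> ordered_eigenvalue k A = ordered_eigenvalue k B"
  by (simp add: ordered_eigenvalue_def char_poly_similar)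

text \<open>Conjugation by \<open>D^(1/2)\<close>, which is invertible because all degrees are
  positive, turns the symmetrized matrix into \<open>L\<close>. In the proof \<open>S\<close> is
  \<open>D^(1/2)\<close> and \<open>T\<close> its inverse.\<close>

lemma normalized_laplacian_similar:
  assumes vs: "distinct vs" and pos: "\<And>v. v \<in> set vs \<Longrightarrow> vertex_degree G v > 0"
  shows "similar_mat (normalized_laplacian G vs) (entries_mat (sym_laplacian_entry G) vs)"
proof -
  define n where "n = length vs"
  define s :: "nat \<Rightarrow> complex" where "s i = of_real (sqrt (vertex_degree G (vs ! i)))" for i
  have s0: "s i \<noteq> 0" if "i < n" for i
    using pos[of "vs ! i"] that by (simp add: s_def n_def)
  have ss: "s i * s i = of_nat (vertex_degree G (vs ! i))" for i
    by (simp add: s_def flip: of_real_mult)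
  define S where "S = mat_diag n s"
  define T where "T = mat_diag n (\<lambda>i. inverse (s i))"
  have ST: "S * T = 1\<^sub>m n" "T * S = 1\<^sub>m n"
    unfolding S_def T_def mat_diag_diag by (auto simp: mat_diag_def s0 intro!: eq_matI)
  have c: "S \<in> carrier_mat n n" "T \<in> carrier_mat n n"
    "normalized_laplacian G vs \<in> carrier_mat n n" "entries_mat (sym_laplacian_entry G) vs \<in> carrier_mat n n"
    by (auto simp: S_def T_def normalized_laplacian_def inverse_degree_matrix_def adjacency_matrix_def
        entries_mat_def n_def intro!: minus_carrier_mat mult_carrier_mat[where n="length vs"])
  \<comment> \<open>The degree is written as \<open>s i * s i\<close> so that one factor can cancel
    in the comparison of entries.\<close>
  have L: "normalized_laplacian G vs $$ (i, j) =
      (if i = j then 1 else 0) - inverse (s i * s i) * adjacency_entry G (vs ! i) (vs ! j)"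
    if "i < n" "j < n" for i j
  proof -
    have "adjacency_matrix G vs \<in> carrier_mat n n"
      by (simp add: adjacency_matrix_def n_def)
    from mat_diag_mult_left[OF this] show ?thesis
      using that by (simp add: normalized_laplacian_def inverse_degree_matrix_def ss
          adjacency_matrix_def flip: n_def)
  qed
  have "normalized_laplacian G vs = T * entries_mat (sym_laplacian_entry G) vs * S"
  proof (rule eq_matI)
    fix i j
    assume "i < dim_row (T * entries_mat (sym_laplacian_entry G) vs * S)"
      "j < dim_col (T * entries_mat (sym_laplacian_entry G) vs * S)"
    then have ij: "i < n" "j < n" using c by auto
    have "(T * entries_mat (sym_laplacian_entry G) vs * S) $$ (i, j)
        = inverse (s i) * sym_laplacian_entry G (vs ! i) (vs ! j) * s j"
      unfolding S_def T_def mat_diag_mult_left[OF c(4)]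
      using ij by (subst mat_diag_mult_right[of _ n]) (auto simp: entries_mat_def n_def)
    also have "\<dots> = normalized_laplacian G vs $$ (i, j)"
      using ij vs s0[OF ij(1)] s0[OF ij(2)] nth_eq_iff_index_eq[OF vs, of i j]
      by (simp add: L sym_laplacian_entry_def n_def field_simps flip: s_def)
    finally show "normalized_laplacian G vs $$ (i, j) = (T * entries_mat (sym_laplacian_entry G) vs * S) $$ (i, j)" ..
  qed (use c in auto)
  then have "similar_mat_wit (normalized_laplacian G vs) (entries_mat (sym_laplacian_entry G) vs) T S"
    using ST c by (intro similar_mat_witI) auto
  then show ?thesis
    by (auto simp: similar_mat_def)
qed

theorem theorem4p6:
  fixes G :: "('v, 'e) hypergraph"
    and G' :: "('v, 'e) hypergraph"
    and us vs ws :: "'v list"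
    and n r :: nat
    and M :: "('v, 'e) hypergraph \<Rightarrow> 'v list \<Rightarrow> complex mat"
  assumes "complex_unit_hypergraph G"
    and "n = card (verts G)"
    and "r \<in> {1..n - 1}"
    and "distinct us" "set us \<subseteq> verts G" "length us = r"
    and "G' = weak_deletions us G"
    and "enumerates vs (verts G)"
    and "enumerates ws (verts G')"
    and "M = adjacency_matrix \<or> M = kirchhoff_laplacian \<or>
         M = normalized_laplacian \<and> (\<forall>v\<in>verts G. vertex_degree G v > 0)"
  shows "\<forall>k\<in>{1..n - r}.
           ordered_eigenvalue k (M G vs) \<le> ordered_eigenvalue k (M G' ws) \<and>
           ordered_eigenvalue k (M G' ws) \<le> ordered_eigenvalue (k + r) (M G vs)"
proof
  fix k assume k: "k \<in> {1..n - r}"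
  have vs: "distinct vs" "set vs = verts G" and ws: "distinct ws" "set ws = verts G - set us"
    using assms(7-9) by (auto simp: enumerates_def verts_weak_deletions)
  have lv: "length vs = n"
    using vs assms(2) distinct_card by fastforce
  have "card (verts G - set us) = n - r"
    using assms(2,4,5,6) by (simp add: card_Diff_subset distinct_card)
  then have lw: "length ws = n - r"
    using ws distinct_card by fastforce
  \<comment> \<open>The bound on \<open>r\<close> ensures that the natural number
    \<open>n - r\<close> is a genuine difference.\<close>
  have len: "length vs = length ws + r"
    using assms(3) lv lw by auto
  have k': "k \<in> {1..length ws}" using k lw by simp
  note ent = weak_deletions_entries[OF assms(1), of _ us, folded assms(7), folded ws(2)]
  note herm = adjacency_entry_hermitian[OF assms(1)]
  \<comment> \<open>Interlacing for any rule \<open>h\<close> that is Hermitian on \<open>G\<close>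
    and unaffected by the deletion; the three operators become instances.\<close>
  have inter: "ordered_eigenvalue k (entries_mat (h G) vs) \<le> ordered_eigenvalue k (entries_mat (h G') ws) \<and>
      ordered_eigenvalue k (entries_mat (h G') ws) \<le> ordered_eigenvalue (k + r) (entries_mat (h G) vs)"
    if "\<And>u v. cnj (h G u v) = h G v u"
      and "\<And>u v. u \<in> set ws \<Longrightarrow> v \<in> set ws \<Longrightarrow> h G' u v = h G u v"
    for h :: "('v, 'e) hypergraph \<Rightarrow> 'v \<Rightarrow> 'v \<Rightarrow> complex"
  proof -
    have "entries_mat (h G') ws = entries_mat (h G) ws"
      by (rule entries_mat_cong) (rule that(2))
    then show ?thesis
      using entries_mat_interlacing[of "h G" vs ws r k, OF that(1) vs(1) ws(1) _ len k'] vs(2) ws(2)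
      by auto
  qed
  from assms(10) show "ordered_eigenvalue k (M G vs) \<le> ordered_eigenvalue k (M G' ws) \<and>
      ordered_eigenvalue k (M G' ws) \<le> ordered_eigenvalue (k + r) (M G vs)"
  proof (elim disjE conjE)
    assume "M = adjacency_matrix"
    then show ?thesis
      using inter[of adjacency_entry] herm ent by (simp add: adjacency_matrix_eq_entries_mat)
  next
    assume "M = kirchhoff_laplacian"
    moreover have "cnj (kirchhoff_entry G u v) = kirchhoff_entry G v u" for u v
      by (auto simp: kirchhoff_entry_def herm)
    moreover have "kirchhoff_entry G' u v = kirchhoff_entry G u v" if "u \<in> set ws" "v \<in> set ws" for u v
      using ent that by (simp add: kirchhoff_entry_def)
    ultimately show ?thesis
      using inter[of kirchhoff_entry] vs(1) ws(1) by (simp add: kirchhoff_laplacian_eq_entries_mat)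
  next
    assume M: "M = normalized_laplacian" and pos: "\<forall>v\<in>verts G. vertex_degree G v > 0"
    have "cnj (sym_laplacian_entry G u v) = sym_laplacian_entry G v u" for u v
      by (auto simp: sym_laplacian_entry_def herm mult.commute)
    \<comment> \<open>Both degrees enter, whereas \<open>ent\<close> gives the degree of its first
      vertex only; hence its two instances.\<close>
    moreover have "sym_laplacian_entry G' u v = sym_laplacian_entry G u v" if "u \<in> set ws" "v \<in> set ws" for u v
      using ent[of u v] ent[of v u] that by (simp add: sym_laplacian_entry_def)
    moreover have "ordered_eigenvalue i (M G vs) = ordered_eigenvalue i (entries_mat (sym_laplacian_entry G) vs)" for i
      unfolding M using vs pos by (intro ordered_eigenvalue_similar normalized_laplacian_similar) auto
    \<comment> \<open>Positivity of the degrees in \<open>G'\<close> is inherited from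
      \<open>G\<close>, since deletion preserves the degrees of surviving vertices.\<close>
    moreover have "ordered_eigenvalue i (M G' ws) = ordered_eigenvalue i (entries_mat (sym_laplacian_entry G') ws)" for i
      unfolding M using ws pos ent
      by (intro ordered_eigenvalue_similar normalized_laplacian_similar) auto
    ultimately show ?thesis
      using inter[of sym_laplacian_entry] by simp
  qed
qed

end
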